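(* If $G$ is a finitely generated group with at least $2$ ends, then $G$ does not admit a strongly aperiodic subshift of finite type.
   Context: For a finite set $A$ and a group $G$, $G$ acts on the right on $A^G$ (product topology, $A$ discrete) by $(\sigma\cdot h)(g)=\sigma(hg)$. A subshift is a closed $G$-invariant subset of $A^G$. A subshift of finite type is a set of the form $X=\bigcap_{g\in G}(C\cdot g)$, where $C=\{\sigma\in A^G:\sigma|_S\in L\}$ for some finite subset $S\subset G$ and some $L\subset A^S$. A nonempty subshift $X\subset A^G$ is strongly aperiodic if every $\sigma\in X$ has trivial stabilizer in $G$, i.e. $\sigma\cdot g=\sigma$ with $\sigma\in X$ implies $g=1_G$. The phrase "$G$ admits a strongly aperiodic subshift of finite type" means that for some finite set $A$ there is a (nonempty) strongly aperiodic subshift of finite type $X\subset A^G$. The number of ends of a group $G$ with finite generating set $S$ is the limit (possibly infinite) as $n\to\infty$ of the number of unbounded connected components of the complement, in the Cayley graph of $G$ with respect to $S$, of the ball of radius $n$ around $1_G$; it does not depend on the choice of $S$. *)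

theory Defs
  imports "HOL-Analysis.Analysis" "HOL-Algebra.Generated_Groups" "HOL-Algebra.Group_Action"
    "Graph_Theory.Digraph_Component"
begin

section \<open>Subshifts\<close>

text \<open>
  Configurations over \<open>A\<close> are the extensional functions \<^term>\<open>carrier G \<rightarrow>\<^sub>E A\<close>, which is the
  underlying set of the product topology below.
\<close>

definition full_shift :: "('g, 'm) monoid_scheme \<Rightarrow> 'a set \<Rightarrow> ('g \<Rightarrow> 'a) topology" where
  "full_shift G A = product_topology (\<lambda>_. discrete_topology A) (carrier G)"

definition shift :: "('g, 'm) monoid_scheme \<Rightarrow> 'g \<Rightarrow> ('g \<Rightarrow> 'a) \<Rightarrow> 'g \<Rightarrow> 'a" where
  "shift G h \<sigma> = (\<lambda>g\<in>carrier G. \<sigma> (h \<otimes>\<^bsub>G\<^esub> g))"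

definition subshift :: "('g, 'm) monoid_scheme \<Rightarrow> 'a set \<Rightarrow> ('g \<Rightarrow> 'a) set \<Rightarrow> bool" where
  "subshift G A X \<longleftrightarrow>
     closedin (full_shift G A) X \<and> (\<forall>h\<in>carrier G. \<forall>\<sigma>\<in>X. shift G h \<sigma> \<in> X)"

definition subshift_of_finite_type ::
    "('g, 'm) monoid_scheme \<Rightarrow> 'a set \<Rightarrow> ('g \<Rightarrow> 'a) set \<Rightarrow> bool" where
  "subshift_of_finite_type G A X \<longleftrightarrow>
     (\<exists>S L. finite S \<and> S \<subseteq> carrier G \<and> L \<subseteq> (S \<rightarrow>\<^sub>E A) \<and>
        X = (\<Inter>g\<in>carrier G. shift G g ` {\<sigma> \<in> carrier G \<rightarrow>\<^sub>E A. restrict \<sigma> S \<in> L}))"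

definition strongly_aperiodic ::
    "('g, 'm) monoid_scheme \<Rightarrow> 'a set \<Rightarrow> ('g \<Rightarrow> 'a) set \<Rightarrow> bool" where
  "strongly_aperiodic G A X \<longleftrightarrow>
     subshift G A X \<and> X \<noteq> {} \<and> (\<forall>\<sigma>\<in>X. stabilizer G (shift G) \<sigma> = {\<one>\<^bsub>G\<^esub>})"

section \<open>Ends\<close>

text \<open>
  An undirected graph is represented by a symmetric digraph. Its connected components are then the
  strongly connected components.
\<close>

definition cayley_graph ::
    "('g, 'm) monoid_scheme \<Rightarrow> 'g set \<Rightarrow> ('g, 'g \<times> 'g) pre_digraph" where
  "cayley_graph G S = with_proj
     \<lparr> pverts = carrier G,
       parcs = (\<Union>g\<in>carrier G. \<Union>s\<in>S. {(g, g \<otimes>\<^bsub>G\<^esub> s), (g \<otimes>\<^bsub>G\<^esub> s, g)}) \<rparr>"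

definition cayley_ball :: "('g, 'm) monoid_scheme \<Rightarrow> 'g set \<Rightarrow> nat \<Rightarrow> 'g set" where
  "cayley_ball G S n =
     {g. \<exists>p. pre_digraph.awalk (cayley_graph G S) \<one>\<^bsub>G\<^esub> p g \<and> length p \<le> n}"

definition unbounded_components :: "('g, 'm) monoid_scheme \<Rightarrow> 'g set \<Rightarrow> nat \<Rightarrow> 'g set set" where
  "unbounded_components G S n =
     {C \<in> pre_digraph.sccs_verts (cayley_graph G S \<restriction> (carrier G - cayley_ball G S n)).
        \<forall>m. \<not> C \<subseteq> cayley_ball G S m}"

text \<open>
  For finite \<open>S\<close> there are finitely many unbounded components at each radius, and their number is
  nondecreasing in the radius, so the limit exists in \<^typ>\<open>enat\<close>.
\<close>

definition number_of_ends :: "('g, 'm) monoid_scheme \<Rightarrow> 'g set \<Rightarrow> enat" where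
  "number_of_ends G S =
     lim (\<lambda>n. if finite (unbounded_components G S n)
              then enat (card (unbounded_components G S n)) else \<infinity>)"

end

theory Submission
  imports Defs
begin

text \<open>
  Let \<open>K\<close> be a ball whose complement splits into infinite parts \<open>P\<close> and \<open>Q\<close> with no edges between
  them. Translates \<open>gK \<subseteq> P\<close> and \<open>hK \<subseteq> Q\<close> exist, and by connectedness each of \<open>P\<close> and \<open>Q\<close> contains
  one of the two sides of its translated cut. In each combination of cases \<open>g\<close>, \<open>h\<inverse>\<close> or \<open>gh\<close> maps
  \<open>P \<union> K\<close> into \<open>P\<close>, so there is \<open>g\<close> with \<open>gP \<subset> P\<close>. As \<open>P\<close> has finite coboundary, the translates
  \<open>g\<^sup>nP\<close> decrease to the empty set and exhaust the group backwards. Given a configuration \<open>\<sigma>\<close> of the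
  subshift, the pigeonhole principle yields two far apart powers of \<open>g\<close> around which \<open>\<sigma>\<close> has the
  same pattern near the boundary of \<open>P\<close>. The strip between the two boundaries then tiles the group
  periodically, and the resulting configuration is still in the subshift.
\<close>

section \<open>Periodic configurations from almost invariant sets\<close>

context group
begin

text \<open>Finiteness of the coboundary, as in the theory of ends, for all group elements so that
  no generating set occurs. Entering elements are covered too: \<open>x\<close> enters
  \<open>H\<close> under \<open>f\<close> exactly when \<open>x \<otimes> f\<close> leaves it under
  \<open>inv f\<close>.\<close>

definition almost_invariant :: "'a set \<Rightarrow> bool" where
  "almost_invariant H \<longleftrightarrow> H \<subseteq> carrier G \<and> (\<forall>f\<in>carrier G. finite {x \<in> H. x \<otimes> f \<notin> H})"

lemma int_pow_add_apply:
  assumes "g \<in> carrier G" "x \<in> carrier G"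
  shows "g [^] (i + j :: int) \<otimes> x = g [^] i \<otimes> (g [^] j \<otimes> x)"
  using assms by (simp add: int_pow_mult m_assoc)

lemma int_pow_neg_one: "g \<in> carrier G \<Longrightarrow> g [^] (- 1 :: int) = inv g"
  by (simp add: int_pow_neg)

section \<open>Orbits under the powers of an element mapping \<open>H\<close> into itself\<close>

context
  fixes g H
  assumes g: "g \<in> carrier G"
    and push: "\<forall>x\<in>H. g \<otimes> x \<in> H"
    and sub: "H \<subseteq> carrier G"
begin

lemma push_nat_pow: "x \<in> H \<Longrightarrow> g [^] (int n) \<otimes> x \<in> H"
proof (induction n)
  case 0
  then show ?case using sub by auto
next
  case (Suc n)
  have "g [^] (int (Suc n)) \<otimes> x = g \<otimes> (g [^] (int n) \<otimes> x)"
    using int_pow_add_apply[of g x 1 "int n"] g sub Suc.prems by auto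
  then show ?case using push Suc by auto
qed

text \<open>Along each orbit of \<open>g\<close> the exponents landing in \<open>H\<close> are
  upward closed, so an orbit crosses into \<open>H\<close> at most once.\<close>

lemma push_mono:
  assumes "x \<in> carrier G" "g [^] (i::int) \<otimes> x \<in> H" "i \<le> j"
  shows "g [^] j \<otimes> x \<in> H"
proof -
  have "g [^] j \<otimes> x = g [^] int (nat (j - i)) \<otimes> (g [^] i \<otimes> x)"
    using int_pow_add_apply[of g x "j - i" i] assms g by simp
  then show ?thesis using push_nat_pow assms by metis
qed

context
  fixes z
  assumes z: "z \<in> carrier G" "z \<notin> H" "g \<otimes> z \<in> H"
begin

text \<open>The point \<open>z\<close> witnesses that \<open>g\<close> maps \<open>H\<close> onto a
  proper subset. Its orbit serves as reference: it lies in \<open>H\<close> exactly for positive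
  exponents.\<close>

lemma pow_z_in: "0 < i \<Longrightarrow> g [^] (i::int) \<otimes> z \<in> H"
  using push_mono[of z 1 i] g z by auto

lemma pow_z_notin: "i \<le> 0 \<Longrightarrow> g [^] (i::int) \<otimes> z \<notin> H"
  using push_mono[of z i 0] z by auto

lemma int_pow_neq_one: "0 < i \<Longrightarrow> g [^] (i::int) \<noteq> \<one>"
  using pow_z_in[of i] z by auto

lemma inj_int_pow_mult:
  assumes "x \<in> carrier G"
  shows "inj (\<lambda>i::int. g [^] i \<otimes> x)"
proof (rule linorder_injI)
  fix i j :: int
  assume "i < j"
  show "g [^] i \<otimes> x \<noteq> g [^] j \<otimes> x"
  proof
    assume "g [^] i \<otimes> x = g [^] j \<otimes> x"
    then have "g [^] i = g [^] j" using assms g by simp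
    then have "g [^] (j - i) = \<one>"
      using g by (simp add: int_pow_diff)
    then show False using int_pow_neq_one[of "j - i"] \<open>i < j\<close> by simp
  qed
qed

context
  assumes inv_H: "almost_invariant H"
begin

text \<open>Right multiplication by the fixed element \<open>inv x \<otimes> y\<close> takes
  \<open>g [^] i \<otimes> x\<close> to \<open>g [^] i \<otimes> y\<close> for every
  \<open>i\<close>. Each such \<open>i\<close> therefore gives an exit from \<open>H\<close> under
  one element, and distinct \<open>i\<close> give distinct exits.\<close>

lemma finite_exits: "x \<in> carrier G \<Longrightarrow> y \<in> carrier G \<Longrightarrow>
    finite {i::int. g [^] i \<otimes> x \<in> H \<and> g [^] i \<otimes> y \<notin> H}"
proof -
  assume x: "x \<in> carrier G" and y: "y \<in> carrier G"
  let ?I = "{i::int. g [^] i \<otimes> x \<in> H \<and> g [^] i \<otimes> y \<notin> H}"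
  have eq: "g [^] i \<otimes> x \<otimes> (inv x \<otimes> y) = g [^] i \<otimes> y" for i :: int
    using g x y by (simp add: inv_solve_left m_assoc flip: m_assoc[of x])
  have "(\<lambda>i. g [^] i \<otimes> x) ` ?I \<subseteq> {w \<in> H. w \<otimes> (inv x \<otimes> y) \<notin> H}"
    using eq by auto
  moreover have "finite {w \<in> H. w \<otimes> (inv x \<otimes> y) \<notin> H}"
    using inv_H x y by (simp add: almost_invariant_def)
  ultimately have "finite ((\<lambda>i. g [^] i \<otimes> x) ` ?I)"
    by (rule finite_subset)
  then show ?thesis
    by (rule finite_imageD) (rule inj_on_subset[OF inj_int_pow_mult[OF x]], simp)
qed

text \<open>Comparison with the reference orbit: if the orbit of \<open>x\<close> stayed outside
  \<open>H\<close> at all positive exponents, each of them would be an exit from the orbit of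
  \<open>z\<close> to that of \<open>x\<close>.\<close>

lemma eventually_in:
  assumes "x \<in> carrier G"
  obtains n where "g [^] int n \<otimes> x \<in> H"
proof (rule ccontr)
  assume "\<not> thesis"
  then have "\<And>n. g [^] int n \<otimes> x \<notin> H" using that by blast
  then have "g [^] i \<otimes> x \<notin> H" if "0 < i" for i :: int
    using that by (metis zero_less_imp_eq_int)
  then have "{0<..} \<subseteq> {i::int. g [^] i \<otimes> z \<in> H \<and> g [^] i \<otimes> x \<notin> H}"
    using pow_z_in by auto
  then show False
    using finite_exits[OF z(1) assms] infinite_Ioi finite_subset by blast
qed

text \<open>The same comparison with the roles of \<open>x\<close> and \<open>z\<close> exchanged,
  over the nonpositive exponents.\<close>

lemma eventually_notin:
  assumes "x \<in> carrier G"
  obtains n where "g [^] (- int n) \<otimes> x \<notin> H"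
proof (rule ccontr)
  assume "\<not> thesis"
  then have *: "\<And>n. g [^] (- int n) \<otimes> x \<in> H" using that by blast
  have "g [^] i \<otimes> x \<in> H" if "i \<le> 0" for i :: int
    using *[of "nat (- i)"] that by simp
  then have "{..0} \<subseteq> {i::int. g [^] i \<otimes> x \<in> H \<and> g [^] i \<otimes> z \<notin> H}"
    using pow_z_notin by auto
  then show False
    using finite_exits[OF assms z(1)] infinite_Iic finite_subset by blast
qed

end
end

text \<open>
  The set \<open>H - gH\<close> is a fundamental domain for \<open>\<langle>g\<rangle>\<close>; the configuration \<open>\<tau>\<close> is the \<open>g\<close>-periodic
  extension of the restriction of \<open>\<sigma>\<close> to it. The margin hypotheses ensure that a translate of \<open>F\<close>
  meets at most two consecutive copies of the domain.
\<close>

lemma periodic_extension: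
  assumes enter: "\<And>x. x \<in> carrier G \<Longrightarrow> \<exists>i::int. g [^] i \<otimes> x \<in> H"
    and exit: "\<And>x. x \<in> carrier G \<Longrightarrow> \<exists>i::int. g [^] i \<otimes> x \<notin> H"
    and F: "F \<subseteq> carrier G"
    and out: "\<And>x f. x \<in> H \<Longrightarrow> f \<in> F \<Longrightarrow> x \<otimes> f \<notin> H \<Longrightarrow>
      g \<otimes> (x \<otimes> f) \<in> H \<and> \<sigma> (g \<otimes> (x \<otimes> f)) = \<sigma> (x \<otimes> f)"
    and inn: "\<And>x f. x \<in> carrier G \<Longrightarrow> x \<notin> H \<Longrightarrow> f \<in> F \<Longrightarrow> x \<otimes> f \<in> H \<Longrightarrow>
      inv g \<otimes> (x \<otimes> f) \<notin> H \<and> \<sigma> (g \<otimes> (x \<otimes> f)) = \<sigma> (x \<otimes> f)"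
  obtains \<tau> where "\<And>x. x \<in> carrier G \<Longrightarrow> \<tau> (g \<otimes> x) = \<tau> x"
    and "\<And>x. x \<in> carrier G \<Longrightarrow> \<exists>y\<in>carrier G. \<forall>f\<in>F. \<tau> (x \<otimes> f) = \<sigma> (y \<otimes> f)"
proof -
  \<comment> \<open>\<open>P x i\<close> says that \<open>g [^] i \<otimes> x\<close> lies in the
    fundamental domain \<open>H - gH\<close>.\<close>
  define P where "P x i \<longleftrightarrow> g [^] i \<otimes> x \<in> H \<and> g [^] (i - 1) \<otimes> x \<notin> H" for x and i :: int
  have ex: "\<exists>i. P x i" if x: "x \<in> carrier G" for x
  proof -
    obtain i where i: "g [^] (i::int) \<otimes> x \<notin> H" using exit x by blast
    obtain k where "g [^] (k::int) \<otimes> x \<in> H" using enter x by blast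
    then have "g [^] (i + int (nat (k - i))) \<otimes> x \<in> H"
      by (rule push_mono[OF x]) simp
    then obtain n where n: "g [^] (i + int n) \<otimes> x \<in> H"
      "\<And>m. m < n \<Longrightarrow> g [^] (i + int m) \<otimes> x \<notin> H"
      using exists_least_iff[of "\<lambda>n. g [^] (i + int n) \<otimes> x \<in> H"] by blast
    have "n \<noteq> 0" using n(1) i by (intro notI) simp
    then have "P x (i + int n)"
      using n(1) n(2)[of "n - 1"] unfolding P_def by (simp add: of_nat_diff algebra_simps)
    then show ?thesis ..
  qed
  have unique: "i = j" if x: "x \<in> carrier G" and ij: "P x i" "P x j" for x i j
    using push_mono[OF x, of i "j - 1"] push_mono[OF x, of j "i - 1"] ij
    unfolding P_def by force
  define \<tau> where "\<tau> x = \<sigma> (g [^] (THE i. P x i) \<otimes> x)" for x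
  have \<tau>: "\<tau> x = \<sigma> (g [^] i \<otimes> x)" if "x \<in> carrier G" "P x i" for x i
    unfolding \<tau>_def using that unique by (metis the_equality)
  have \<tau>_pow: "\<tau> (g [^] k \<otimes> x) = \<tau> x" if x: "x \<in> carrier G" for x and k :: int
  proof -
    obtain i where i: "P x i" using ex x by blast
    have shift: "g [^] (j - k) \<otimes> (g [^] k \<otimes> x) = g [^] j \<otimes> x" for j
      using int_pow_add_apply[of g x "j - k" k] g x by simp
    have "P (g [^] k \<otimes> x) (i - k)"
      using i shift[of i] shift[of "i - 1"] unfolding P_def by (simp add: algebra_simps)
    then show ?thesis using \<tau> i x g shift by simp
  qed
  show thesis
  proof
    fix x assume x: "x \<in> carrier G"
    show "\<tau> (g \<otimes> x) = \<tau> x" using \<tau>_pow[OF x, of 1] g by simp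
    obtain i where i: "P x i" using ex x by blast
    \<comment> \<open>\<open>y\<close> represents the orbit of \<open>x\<close> in the fundamental
      domain; the pattern of \<open>\<tau>\<close> at \<open>x\<close> will be that of
      \<open>\<sigma>\<close> at \<open>y\<close>.\<close>
    define y where "y = g [^] i \<otimes> x"
    have y: "y \<in> H" "y \<in> carrier G" using i sub unfolding y_def P_def by auto
    have y': "inv g \<otimes> y \<notin> H"
      using i int_pow_add_apply[of g x "- 1" i] g x unfolding y_def P_def by (simp add: int_pow_neg_one)
    have "\<tau> (x \<otimes> f) = \<sigma> (y \<otimes> f)" if f: "f \<in> F" for f
    proof -
      define w where "w = y \<otimes> f"
      have fc: "f \<in> carrier G" using f F by blast
      have w: "w \<in> carrier G" unfolding w_def using y fc by simp
      have "w = g [^] i \<otimes> (x \<otimes> f)" unfolding w_def y_def using x g fc by (simp add: m_assoc)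
      then have eq: "\<tau> (x \<otimes> f) = \<tau> w" using \<tau>_pow x fc by simp
      \<comment> \<open>By the margins \<open>w\<close> lies in the domain or in one of its two
        neighbouring copies, so its exponent is 1, 0 or -1. In the outer cases
        \<open>\<sigma>\<close> takes the same value at \<open>w\<close> and at its
        representative.\<close>
      have "\<tau> w = \<sigma> w"
      proof (cases "w \<in> H")
        case False
        then have "g \<otimes> w \<in> H" "\<sigma> (g \<otimes> w) = \<sigma> w" using out[OF y(1) f] unfolding w_def by auto
        then show ?thesis using False \<tau>[OF w, of 1] g w unfolding P_def by simp
      next
        case True
        show ?thesis
        proof (cases "inv g \<otimes> w \<in> H")
          case False
          then show ?thesis using True \<tau>[OF w, of 0] g w unfolding P_def by (simp add: int_pow_neg_one)
        next
          case 2: True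
          have eq2: "inv g \<otimes> y \<otimes> f = inv g \<otimes> w"
            unfolding w_def using g y fc by (simp add: m_assoc)
          have gw: "g \<otimes> (inv g \<otimes> w) = w" using g w by (simp add: flip: m_assoc)
          \<comment> \<open>\<open>inn\<close> is applied at \<open>inv g \<otimes> y\<close>, which
            is outside \<open>H\<close> because \<open>y\<close> is in the fundamental
            domain.\<close>
          have "inv g \<otimes> (inv g \<otimes> w) \<notin> H" "\<sigma> w = \<sigma> (inv g \<otimes> w)"
            using inn[of "inv g \<otimes> y" f] y' y f 2 g gw unfolding eq2 by auto
          moreover have "g [^] (- 1 - 1 :: int) \<otimes> w = inv g \<otimes> (inv g \<otimes> w)"
            using int_pow_add_apply[of g w "- 1" "- 1"] g w by (simp add: int_pow_neg_one)
          ultimately show ?thesis using 2 \<tau>[OF w, of "- 1"] g unfolding P_def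
            by (simp add: int_pow_neg_one)
        qed
      qed
      then show ?thesis using eq unfolding w_def by simp
    qed
    then show "\<exists>y\<in>carrier G. \<forall>f\<in>F. \<tau> (x \<otimes> f) = \<sigma> (y \<otimes> f)" using y by blast
  qed
qed

end

text \<open>A large power of \<open>g\<close> clears the finite \<open>F\<close>-boundary of
  \<open>H\<close>, and by pigeonhole two such powers show the same pattern of
  \<open>\<sigma>\<close> there. Their quotient \<open>h\<close> satisfies the margin hypotheses of
  \<open>periodic_extension\<close>.\<close>

lemma periodic_point_of_push:
  assumes g: "g \<in> carrier G" and push: "\<forall>x\<in>H. g \<otimes> x \<in> H"
    and H: "almost_invariant H"
    and z: "z \<in> carrier G" "z \<notin> H" "g \<otimes> z \<in> H"
    and "finite F" and F: "F \<subseteq> carrier G"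
    and "finite A" and \<sigma>: "\<sigma> \<in> carrier G \<rightarrow> A"
  obtains h \<tau> where "h \<in> carrier G" "h \<noteq> \<one>"
    and "\<forall>x\<in>carrier G. \<tau> (h \<otimes> x) = \<tau> x"
    and "\<forall>x\<in>carrier G. \<exists>y\<in>carrier G. \<forall>f\<in>F. \<tau> (x \<otimes> f) = \<sigma> (y \<otimes> f)"
proof -
  have sub: "H \<subseteq> carrier G" using H by (simp add: almost_invariant_def)
  note mono = push_mono[OF g push sub]
  \<comment> \<open>\<open>V\<close> is the outer boundary, reached from \<open>H\<close> by a step
    in \<open>F\<close>; \<open>W\<close> is the inner one, reached from outside. Almost invariance
    makes both finite.\<close>
  define V where "V = (\<Union>f\<in>F. (\<lambda>x. x \<otimes> f) ` {x \<in> H. x \<otimes> f \<notin> H})"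
  define W where "W = (\<Union>f\<in>F. {w \<in> H. w \<otimes> inv f \<notin> H})"
  have fin: "finite V" "finite W"
    using H F \<open>finite F\<close> unfolding V_def W_def almost_invariant_def by auto
  have V: "V \<subseteq> carrier G" and W: "W \<subseteq> carrier G"
    using sub F unfolding V_def W_def by auto
  have "\<forall>w\<in>V. \<exists>n. g [^] int n \<otimes> w \<in> H"
    using eventually_in[OF g push sub z H] V by (metis subsetD)
  then obtain a where a: "\<And>w. w \<in> V \<Longrightarrow> g [^] int (a w) \<otimes> w \<in> H" by metis
  have "\<forall>w\<in>W. \<exists>n. g [^] (- int n) \<otimes> w \<notin> H"
    using eventually_notin[OF g push sub z H] W by (metis subsetD)
  then obtain b where b: "\<And>w. w \<in> W \<Longrightarrow> g [^] (- int (b w)) \<otimes> w \<notin> H" by metis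
  \<comment> \<open>One exponent that pushes all of \<open>V\<close> into \<open>H\<close> and pulls
    all of \<open>W\<close> out of it. \<open>Suc\<close> makes it positive, so that
    \<open>k\<close> below is positive.\<close>
  define N where "N = Suc (Max (insert 0 (a ` V \<union> b ` W)))"
  have "a w < N" if "w \<in> V" for w
    using that fin unfolding N_def by (simp add: le_imp_less_Suc)
  then have aN: "g [^] n \<otimes> w \<in> H" if "w \<in> V" "int N \<le> n" for w n
    using that V mono[OF _ a[of w], of n] by fastforce
  have "b w < N" if "w \<in> W" for w
    using that fin unfolding N_def by (simp add: le_imp_less_Suc)
  then have bN: "g [^] (- n) \<otimes> w \<notin> H" if "w \<in> W" "int N \<le> n" for w n
    using that W b[of w] mono[of w "- n" "- int (b w)"] by fastforce
  \<comment> \<open>Sampling at multiples of \<open>N\<close> makes any two distinct samples at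
    least \<open>N\<close> powers apart.\<close>
  define pat where "pat i = (\<lambda>w\<in>V \<union> W. \<sigma> (g [^] (int N * int i) \<otimes> w))" for i :: nat
  have "pat i \<in> (V \<union> W) \<rightarrow>\<^sub>E A" for i
    unfolding pat_def restrict_PiE_iff
  proof
    fix w assume "w \<in> V \<union> W"
    then have "g [^] (int N * int i) \<otimes> w \<in> carrier G" using V W g by blast
    then show "\<sigma> (g [^] (int N * int i) \<otimes> w) \<in> A" by (rule funcset_mem[OF \<sigma>])
  qed
  then have "range pat \<subseteq> (V \<union> W) \<rightarrow>\<^sub>E A" by (rule image_subsetI)
  moreover have "finite ((V \<union> W) \<rightarrow>\<^sub>E A)" using fin \<open>finite A\<close> by (simp add: finite_PiE)
  ultimately have "finite (range pat)" by (rule finite_subset)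
  then have "\<not> inj pat" using finite_imageD[of pat UNIV] infinite_UNIV_nat by auto
  then obtain i j where ij: "i < j" "pat i = pat j"
    using linorder_injI[of pat] by auto
  define k where "k = int N * int (j - i)"
  have k: "int N \<le> k" "0 < k" using ij unfolding k_def N_def by auto
  define h where "h = g [^] k"
  have h: "h \<in> carrier G" using g unfolding h_def by simp
  \<comment> \<open>Moving the first of the two equal patterns to the boundary itself turns their
    equality into \<open>agree\<close>.\<close>
  define \<sigma>' where "\<sigma>' x = \<sigma> (g [^] (int N * int i) \<otimes> x)" for x
  have agree: "\<sigma>' (h \<otimes> w) = \<sigma>' w" if w: "w \<in> V \<union> W" for w
  proof -
    have "int N * int i + k = int N * int j"
      using ij unfolding k_def by (simp add: of_nat_diff algebra_simps)
    then have "\<sigma>' (h \<otimes> w) = \<sigma> (g [^] (int N * int j) \<otimes> w)"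
      using int_pow_add_apply[OF g, of w "int N * int i" k] w V W unfolding \<sigma>'_def h_def by auto
    also have "\<dots> = \<sigma>' w"
      using fun_cong[OF ij(2), of w] w unfolding pat_def \<sigma>'_def by auto
    finally show ?thesis .
  qed
  have pow_h: "h [^] n = g [^] (k * n)" for n :: int
    using g unfolding h_def by (simp add: int_pow_pow)
  have push_h: "\<forall>x\<in>H. h \<otimes> x \<in> H"
    using mono[of _ 0 k] sub k unfolding h_def by auto
  have enter: "\<exists>n::int. h [^] n \<otimes> x \<in> H" if x: "x \<in> carrier G" for x
  proof -
    obtain n where "g [^] int n \<otimes> x \<in> H" using eventually_in[OF g push sub z H x] .
    moreover have "int n \<le> k * int n" using mult_right_mono[of 1 k "int n"] k by simp
    ultimately have "h [^] int n \<otimes> x \<in> H"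
      using mono[OF x] unfolding pow_h by blast
    then show ?thesis ..
  qed
  have exit: "\<exists>n::int. h [^] n \<otimes> x \<notin> H" if x: "x \<in> carrier G" for x
  proof -
    obtain n where n: "g [^] (- int n) \<otimes> x \<notin> H" using eventually_notin[OF g push sub z H x] .
    have "k * (- int n) \<le> - int n" using mult_right_mono[of 1 k "int n"] k by simp
    then have "h [^] (- int n) \<otimes> x \<notin> H"
      using n mono[OF x] unfolding pow_h by blast
    then show ?thesis ..
  qed
  have out: "h \<otimes> (x \<otimes> f) \<in> H \<and> \<sigma>' (h \<otimes> (x \<otimes> f)) = \<sigma>' (x \<otimes> f)"
    if "x \<in> H" "f \<in> F" "x \<otimes> f \<notin> H" for x f
  proof -
    have "x \<otimes> f \<in> V" using that unfolding V_def by blast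
    then show ?thesis using aN[OF _ k(1)] agree unfolding h_def by blast
  qed
  have inn: "inv h \<otimes> (x \<otimes> f) \<notin> H \<and> \<sigma>' (h \<otimes> (x \<otimes> f)) = \<sigma>' (x \<otimes> f)"
    if "x \<in> carrier G" "x \<notin> H" "f \<in> F" "x \<otimes> f \<in> H" for x f
  proof -
    have f: "f \<in> carrier G" using that F by blast
    then have "x \<otimes> f \<otimes> inv f = x" using that by (simp add: m_assoc)
    then have "x \<otimes> f \<in> {w \<in> H. w \<otimes> inv f \<notin> H}" using that by simp
    then have "x \<otimes> f \<in> W" using that unfolding W_def by blast
    moreover have "inv h = g [^] (- k)" using g unfolding h_def by (simp add: int_pow_neg)
    ultimately show ?thesis using bN[OF _ k(1)] agree by simp
  qed
  obtain \<tau> where \<tau>: "\<And>x. x \<in> carrier G \<Longrightarrow> \<tau> (h \<otimes> x) = \<tau> x"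
    "\<And>x. x \<in> carrier G \<Longrightarrow> \<exists>y\<in>carrier G. \<forall>f\<in>F. \<tau> (x \<otimes> f) = \<sigma>' (y \<otimes> f)"
    using periodic_extension[OF h push_h sub _ _ F, where \<sigma> = \<sigma>'] enter exit out inn by blast
  show thesis
  proof
    show "h \<in> carrier G" by fact
    show "h \<noteq> \<one>" using int_pow_neq_one[OF g push sub z k(2)] unfolding h_def .
    show "\<forall>x\<in>carrier G. \<tau> (h \<otimes> x) = \<tau> x" using \<tau>(1) by blast
  next
    show "\<forall>x\<in>carrier G. \<exists>y\<in>carrier G. \<forall>f\<in>F. \<tau> (x \<otimes> f) = \<sigma> (y \<otimes> f)"
    proof
      fix x assume "x \<in> carrier G"
      then obtain y where y: "y \<in> carrier G" "\<forall>f\<in>F. \<tau> (x \<otimes> f) = \<sigma>' (y \<otimes> f)" using \<tau>(2) by blast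
      moreover have "g [^] (int N * int i) \<otimes> y \<otimes> f = g [^] (int N * int i) \<otimes> (y \<otimes> f)" if "f \<in> F" for f
        using that y(1) g F by (intro m_assoc) auto
      ultimately have "\<forall>f\<in>F. \<tau> (x \<otimes> f) = \<sigma> (g [^] (int N * int i) \<otimes> y \<otimes> f)"
        unfolding \<sigma>'_def by simp
      then show "\<exists>y\<in>carrier G. \<forall>f\<in>F. \<tau> (x \<otimes> f) = \<sigma> (y \<otimes> f)"
        using y(1) g by (meson int_pow_closed m_closed)
    qed
  qed
qed

section \<open>Membership in a subshift of finite type, and its periodic points\<close>

lemma shift_closed: "h \<in> carrier G \<Longrightarrow> \<sigma> \<in> carrier G \<rightarrow>\<^sub>E A \<Longrightarrow> shift G h \<sigma> \<in> carrier G \<rightarrow>\<^sub>E A"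
  unfolding shift_def restrict_PiE_iff by (blast intro: PiE_mem)

lemma shift_inv_shift:
  assumes "h \<in> carrier G" "\<sigma> \<in> carrier G \<rightarrow>\<^sub>E A"
  shows "shift G h (shift G (inv h) \<sigma>) = \<sigma>"
proof
  fix x
  show "shift G h (shift G (inv h) \<sigma>) x = \<sigma> x"
    using PiE_arb[OF assms(2)] assms(1)
    by (cases "x \<in> carrier G") (simp_all add: shift_def flip: m_assoc)
qed

lemma mem_finite_type_iff:
  "\<sigma> \<in> (\<Inter>g\<in>carrier G. shift G g ` {\<sigma> \<in> carrier G \<rightarrow>\<^sub>E A. restrict \<sigma> F \<in> L}) \<longleftrightarrow>
    \<sigma> \<in> carrier G \<rightarrow>\<^sub>E A \<and> (\<forall>g\<in>carrier G. restrict (shift G g \<sigma>) F \<in> L)"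
  (is "\<sigma> \<in> ?X \<longleftrightarrow> ?R")
proof
  assume \<sigma>: "\<sigma> \<in> ?X"
  then have "\<sigma> \<in> shift G \<one> ` {\<sigma> \<in> carrier G \<rightarrow>\<^sub>E A. restrict \<sigma> F \<in> L}" by blast
  then have "\<sigma> \<in> carrier G \<rightarrow>\<^sub>E A" using shift_closed[OF one_closed] by blast
  moreover have "restrict (shift G g \<sigma>) F \<in> L" if g: "g \<in> carrier G" for g
  proof -
    obtain \<rho> where \<rho>: "\<rho> \<in> carrier G \<rightarrow>\<^sub>E A" "restrict \<rho> F \<in> L" "\<sigma> = shift G (inv g) \<rho>"
      using INT_D[OF \<sigma> inv_closed[OF g]] by blast
    then show ?thesis using shift_inv_shift[OF g \<rho>(1)] by metis
  qed
  ultimately show ?R by blast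
next
  assume R: ?R
  show "\<sigma> \<in> ?X"
  proof
    fix g assume g: "g \<in> carrier G"
    have "\<sigma> = shift G g (shift G (inv g) \<sigma>)" using shift_inv_shift[OF g] R by metis
    moreover have "shift G (inv g) \<sigma> \<in> {\<sigma> \<in> carrier G \<rightarrow>\<^sub>E A. restrict \<sigma> F \<in> L}"
      using R inv_closed[OF g] shift_closed by blast
    ultimately show "\<sigma> \<in> shift G g ` {\<sigma> \<in> carrier G \<rightarrow>\<^sub>E A. restrict \<sigma> F \<in> L}"
      by (rule image_eqI)
  qed
qed

proposition not_strongly_aperiodic_of_push:
  assumes g: "g \<in> carrier G" and push: "\<forall>x\<in>H. g \<otimes> x \<in> H"
    and H: "almost_invariant H"
    and z: "z \<in> carrier G" "z \<notin> H" "g \<otimes> z \<in> H"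
    and A: "finite A" and X: "subshift_of_finite_type G A X"
  shows "\<not> strongly_aperiodic G A X"
proof
  assume aper: "strongly_aperiodic G A X"
  obtain F L where F: "finite F" "F \<subseteq> carrier G"
    and X_iff: "\<And>\<sigma>. \<sigma> \<in> X \<longleftrightarrow> \<sigma> \<in> carrier G \<rightarrow>\<^sub>E A \<and> (\<forall>g\<in>carrier G. restrict (shift G g \<sigma>) F \<in> L)"
  proof -
    obtain F L where "finite F" "F \<subseteq> carrier G"
      and "X = (\<Inter>g\<in>carrier G. shift G g ` {\<sigma> \<in> carrier G \<rightarrow>\<^sub>E A. restrict \<sigma> F \<in> L})"
      using X unfolding subshift_of_finite_type_def by blast
    then show thesis by (intro that[of F L]) (simp_all only: mem_finite_type_iff)
  qed
  obtain \<sigma> where \<sigma>: "\<sigma> \<in> X" using aper unfolding strongly_aperiodic_def by blast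
  then have \<sigma>A: "\<sigma> \<in> carrier G \<rightarrow> A" unfolding X_iff PiE_def by simp
  \<comment> \<open>Adjoining \<open>\<one>\<close> makes every value of \<open>\<tau>\<close> a
    value of \<open>\<sigma>\<close>, hence a letter of \<open>A\<close>.\<close>
  have F': "finite (insert \<one> F)" "insert \<one> F \<subseteq> carrier G" using F by auto
  obtain h \<tau> where h: "h \<in> carrier G" "h \<noteq> \<one>"
    and per: "\<forall>x\<in>carrier G. \<tau> (h \<otimes> x) = \<tau> x"
    and loc: "\<forall>x\<in>carrier G. \<exists>y\<in>carrier G. \<forall>f\<in>insert \<one> F. \<tau> (x \<otimes> f) = \<sigma> (y \<otimes> f)"
    by (rule periodic_point_of_push[OF g push H z F' A \<sigma>A])
  define \<tau>' where "\<tau>' = restrict \<tau> (carrier G)"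
  have "\<tau>' \<in> X"
    unfolding X_iff
  proof (intro conjI ballI)
    show "\<tau>' \<in> carrier G \<rightarrow>\<^sub>E A"
      unfolding \<tau>'_def restrict_PiE_iff
    proof
      fix x assume x: "x \<in> carrier G"
      then obtain y where "y \<in> carrier G" "\<tau> x = \<sigma> y" using bspec[OF loc x] by auto
      then show "\<tau> x \<in> A" using funcset_mem[OF \<sigma>A] by simp
    qed
    fix x assume x: "x \<in> carrier G"
    then obtain y where y: "y \<in> carrier G" "\<forall>f\<in>F. \<tau> (x \<otimes> f) = \<sigma> (y \<otimes> f)" using loc by blast
    have "restrict (shift G x \<tau>') F = restrict (shift G y \<sigma>) F"
    proof (rule restrict_ext)
      fix f assume "f \<in> F"
      then show "shift G x \<tau>' f = shift G y \<sigma> f"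
        using x y(2) F(2) unfolding \<tau>'_def shift_def by (simp add: subset_iff)
    qed
    then show "restrict (shift G x \<tau>') F \<in> L" using \<sigma> y(1) unfolding X_iff by simp
  qed
  moreover have "shift G h \<tau>' = \<tau>'"
    unfolding shift_def \<tau>'_def by (rule restrict_ext) (simp add: h per)
  ultimately show False
    using aper h unfolding strongly_aperiodic_def stabilizer_def by blast
qed

end

section \<open>Cutting a Cayley graph\<close>

locale finitely_generated_group = group G for G (structure) +
  fixes S :: "'a set"
  assumes finite_S: "finite S" and S_sub: "S \<subseteq> carrier G" and generate_S: "generate G S = carrier G"
begin

abbreviation Cay :: "('a, 'a \<times> 'a) pre_digraph" where
  "Cay \<equiv> cayley_graph G S"

lemma verts_Cay: "verts Cay = carrier G"
  by (simp add: cayley_graph_def)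

lemma dominates_iff:
  "x \<rightarrow>\<^bsub>Cay\<^esub> y \<longleftrightarrow> x \<in> carrier G \<and> y \<in> carrier G \<and> (\<exists>s\<in>S. y = x \<otimes> s \<or> x = y \<otimes> s)"
  using S_sub by (auto simp: cayley_graph_def)

sublocale Cay: sym_digraph Cay
proof
  show "tail Cay e \<in> verts Cay" "head Cay e \<in> verts Cay" if "e \<in> arcs Cay" for e
    using that S_sub by (auto simp: cayley_graph_def)
  show "symmetric Cay"
    unfolding symmetric_def sym_def dominates_iff by blast
qed

lemma dominates_sym: "x \<rightarrow>\<^bsub>Cay\<^esub> y \<Longrightarrow> y \<rightarrow>\<^bsub>Cay\<^esub> x"
  unfolding dominates_iff by blast

lemma dominates_carrier:
  assumes "x \<rightarrow>\<^bsub>Cay\<^esub> y"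
  shows "x \<in> carrier G" "y \<in> carrier G"
  using assms unfolding dominates_iff by auto

lemma dominates_mult_left: "g \<in> carrier G \<Longrightarrow> x \<rightarrow>\<^bsub>Cay\<^esub> y \<Longrightarrow> (g \<otimes> x) \<rightarrow>\<^bsub>Cay\<^esub> (g \<otimes> y)"
  unfolding dominates_iff using S_sub by (metis m_assoc m_closed subsetD)

lemma finite_dominated: "finite {y. x \<rightarrow>\<^bsub>Cay\<^esub> y}"
proof (rule finite_subset)
  show "{y. x \<rightarrow>\<^bsub>Cay\<^esub> y} \<subseteq> (\<lambda>s. x \<otimes> s) ` S \<union> (\<lambda>s. x \<otimes> inv s) ` S"
  proof
    fix y assume "y \<in> {y. x \<rightarrow>\<^bsub>Cay\<^esub> y}"
    then obtain s where s: "s \<in> S" "y = x \<otimes> s \<or> x = y \<otimes> s" and y: "y \<in> carrier G"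
      unfolding dominates_iff by blast
    have "s \<in> carrier G" using s S_sub by blast
    then have "y = x \<otimes> s \<or> y = x \<otimes> inv s" using s y by (auto simp: m_assoc)
    then show "y \<in> (\<lambda>s. x \<otimes> s) ` S \<union> (\<lambda>s. x \<otimes> inv s) ` S" using s by blast
  qed
qed (use finite_S in simp)

text \<open>Connectedness of the induced subgraph, phrased without walks: a part of \<open>T\<close>
  closed under edges inside \<open>T\<close> is all or nothing.\<close>

definition connected_set :: "'a set \<Rightarrow> bool" where
  "connected_set T \<longleftrightarrow>
     (\<forall>C. (\<forall>x\<in>T \<inter> C. \<forall>y\<in>T. x \<rightarrow>\<^bsub>Cay\<^esub> y \<longrightarrow> y \<in> C) \<longrightarrow> T \<subseteq> C \<or> T \<inter> C = {})"

lemma connected_setD: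
  assumes "connected_set T" "\<And>x y. x \<in> T \<Longrightarrow> x \<in> C \<Longrightarrow> y \<in> T \<Longrightarrow> x \<rightarrow>\<^bsub>Cay\<^esub> y \<Longrightarrow> y \<in> C"
  shows "T \<subseteq> C \<or> T \<inter> C = {}"
  using assms unfolding connected_set_def by blast

text \<open>Right multiplication by a generator or its inverse follows an edge, and edges are
  symmetric. Membership in \<open>C\<close> is thus invariant under \<open>generate G S\<close>, so
  every element behaves like \<open>\<one>\<close>.\<close>

lemma connected_set_carrier: "connected_set (carrier G)"
  unfolding connected_set_def
proof (intro allI impI)
  fix C assume C: "\<forall>x\<in>carrier G \<inter> C. \<forall>y\<in>carrier G. x \<rightarrow>\<^bsub>Cay\<^esub> y \<longrightarrow> y \<in> C"
  have mult: "f \<in> generate G S \<Longrightarrow> \<forall>x\<in>carrier G. x \<otimes> f \<in> C \<longleftrightarrow> x \<in> C" for f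
  proof (induction rule: generate.induct)
    case (incl s)
    show ?case
    proof
      fix x assume x: "x \<in> carrier G"
      then have "x \<rightarrow>\<^bsub>Cay\<^esub> (x \<otimes> s)" "(x \<otimes> s) \<rightarrow>\<^bsub>Cay\<^esub> x"
        using incl S_sub unfolding dominates_iff by auto
      then show "x \<otimes> s \<in> C \<longleftrightarrow> x \<in> C" using C dominates_carrier by blast
    qed
  next
    case (inv s)
    show ?case
    proof
      fix x assume x: "x \<in> carrier G"
      have s: "s \<in> carrier G" using inv S_sub by blast
      then have "x = x \<otimes> inv s \<otimes> s" using x by (simp add: m_assoc)
      then have "x \<rightarrow>\<^bsub>Cay\<^esub> (x \<otimes> inv s)" "(x \<otimes> inv s) \<rightarrow>\<^bsub>Cay\<^esub> x"
        using inv x s unfolding dominates_iff by auto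
      then show "x \<otimes> inv s \<in> C \<longleftrightarrow> x \<in> C" using C dominates_carrier by blast
    qed
  next
    case (eng a b)
    then have "a \<in> carrier G" "b \<in> carrier G" using generate_S by auto
    then show ?case using eng by (simp flip: m_assoc)
  qed simp
  have "y \<in> C \<longleftrightarrow> \<one> \<in> C" if "y \<in> carrier G" for y
    using bspec[OF mult one_closed, of y] generate_S that by simp
  then show "carrier G \<subseteq> C \<or> carrier G \<inter> C = {}" by blast
qed

lemma mem_l_coset_iff:
  assumes "g \<in> carrier G" "T \<subseteq> carrier G"
  shows "y \<in> g <# T \<longleftrightarrow> y \<in> carrier G \<and> inv g \<otimes> y \<in> T"
proof
  assume "y \<in> g <# T"
  then obtain x where "x \<in> T" "y = g \<otimes> x" unfolding l_coset_def by blast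
  then show "y \<in> carrier G \<and> inv g \<otimes> y \<in> T"
    using assms by (auto simp flip: m_assoc)
next
  assume y: "y \<in> carrier G \<and> inv g \<otimes> y \<in> T"
  then have "y = g \<otimes> (inv g \<otimes> y)" using assms by (simp flip: m_assoc)
  then show "y \<in> g <# T" using y unfolding l_coset_def by blast
qed

text \<open>Left multiplication preserves edges, so a closed set can be pulled back along
  it.\<close>

lemma connected_set_translate:
  assumes T: "connected_set T" and g: "g \<in> carrier G"
  shows "connected_set (g <# T)"
  unfolding connected_set_def
proof (intro allI impI)
  fix C assume C: "\<forall>x\<in>(g <# T) \<inter> C. \<forall>y\<in>g <# T. x \<rightarrow>\<^bsub>Cay\<^esub> y \<longrightarrow> y \<in> C"
  have "T \<subseteq> {x. g \<otimes> x \<in> C} \<or> T \<inter> {x. g \<otimes> x \<in> C} = {}"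
  proof (rule connected_setD[OF T])
    fix x y assume "x \<in> T" "x \<in> {x. g \<otimes> x \<in> C}" "y \<in> T" "x \<rightarrow>\<^bsub>Cay\<^esub> y"
    then show "y \<in> {x. g \<otimes> x \<in> C}"
      using C dominates_mult_left[OF g, of x y] unfolding l_coset_def by blast
  qed
  then show "g <# T \<subseteq> C \<or> (g <# T) \<inter> C = {}" unfolding l_coset_def by blast
qed

end

section \<open>Cuts with two sides, and an element pushing one side into itself\<close>

locale cayley_cut = finitely_generated_group G S for G (structure) and S +
  fixes K P Q :: "'a set"
  assumes finite_K: "finite K" and one_K: "\<one> \<in> K" and connected_K: "connected_set K"
    and carrier_eq: "carrier G = K \<union> P \<union> Q"
    and disjoint: "K \<inter> P = {}" "K \<inter> Q = {}" "P \<inter> Q = {}"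
    and no_edge: "\<And>x y. x \<in> P \<Longrightarrow> y \<in> Q \<Longrightarrow> \<not> x \<rightarrow>\<^bsub>Cay\<^esub> y"
begin

lemma swap: "cayley_cut G S K Q P"
  by unfold_locales
    (use finite_K one_K connected_K carrier_eq disjoint no_edge dominates_sym in blast)+

lemma subs: "K \<subseteq> carrier G" "P \<subseteq> carrier G" "Q \<subseteq> carrier G"
  using carrier_eq by auto

lemma step: "x \<in> P \<Longrightarrow> x \<rightarrow>\<^bsub>Cay\<^esub> y \<Longrightarrow> y \<in> P \<union> K"
  using no_edge dominates_carrier(2) carrier_eq by blast

text \<open>If \<open>C\<close> contains \<open>K\<close>, then \<open>P - C\<close> is closed under
  edges of the whole graph; if \<open>C\<close> misses \<open>K\<close>, then
  \<open>P \<inter> C\<close> is. Either set misses \<open>\<one>\<close>, so it is empty by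
  connectedness of the group.\<close>

lemma connected_side: "connected_set (P \<union> K)"
  unfolding connected_set_def
proof (intro allI impI)
  fix C assume C: "\<forall>x\<in>(P \<union> K) \<inter> C. \<forall>y\<in>P \<union> K. x \<rightarrow>\<^bsub>Cay\<^esub> y \<longrightarrow> y \<in> C"
  have "K \<subseteq> C \<or> K \<inter> C = {}"
    by (rule connected_setD[OF connected_K]) (use C in blast)
  then show "P \<union> K \<subseteq> C \<or> (P \<union> K) \<inter> C = {}"
  proof
    assume K: "K \<subseteq> C"
    have "carrier G \<subseteq> P - C \<or> carrier G \<inter> (P - C) = {}"
    proof (rule connected_setD[OF connected_set_carrier])
      fix x y assume x: "x \<in> P - C" and xy: "x \<rightarrow>\<^bsub>Cay\<^esub> y"
      then have "y \<in> P \<union> K" using step by blast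
      moreover from this have "y \<notin> C" using C x dominates_sym[OF xy] by blast
      ultimately show "y \<in> P - C" using K by blast
    qed
    then show ?thesis using K subs one_K disjoint by blast
  next
    assume K: "K \<inter> C = {}"
    have "carrier G \<subseteq> P \<inter> C \<or> carrier G \<inter> (P \<inter> C) = {}"
    proof (rule connected_setD[OF connected_set_carrier])
      fix x y assume x: "x \<in> P \<inter> C" and xy: "x \<rightarrow>\<^bsub>Cay\<^esub> y"
      then have "y \<in> P \<union> K" using step by blast
      moreover from this have "y \<in> C" using C x xy by blast
      ultimately show "y \<in> P \<inter> C" using K by blast
    qed
    then show ?thesis using K subs one_K disjoint by blast
  qed
qed

lemma connected_avoiding:
  assumes "connected_set T" "T \<inter> K = {}"
  shows "T \<subseteq> P \<or> T \<inter> P = {}"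
  by (rule connected_setD[OF assms(1)]) (use step assms(2) in blast)

lemma connected_avoiding_translate:
  assumes T: "connected_set T" "T \<subseteq> carrier G" and g: "g \<in> carrier G" and "T \<inter> (g <# K) = {}"
  shows "T \<subseteq> g <# P \<or> T \<inter> (g <# P) = {}"
proof -
  have mem: "x \<in> inv g <# T \<longleftrightarrow> x \<in> carrier G \<and> g \<otimes> x \<in> T" for x
    using mem_l_coset_iff[of "inv g" T x] T(2) g by simp
  have "(inv g <# T) \<inter> K = {}"
    using assms(4) subs mem unfolding mem_l_coset_iff[OF g subs(1)] l_coset_def by blast
  then have "(inv g <# T) \<subseteq> P \<or> (inv g <# T) \<inter> P = {}"
    using connected_avoiding connected_set_translate[OF T(1)] g by simp
  moreover have "x \<in> T \<Longrightarrow> inv g \<otimes> x \<in> inv g <# T" for x unfolding l_coset_def by blast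
  ultimately show ?thesis
    unfolding subset_iff disjoint_iff mem_l_coset_iff[OF g subs(2)] using T(2) by blast
qed

text \<open>\<open>K\<close> avoids \<open>g <# K\<close>, so it lies in \<open>g <# P\<close> or
  misses it. The translated side without \<open>K\<close>, together with \<open>g <# K\<close>, is
  connected, avoids \<open>K\<close> and meets \<open>P\<close> in \<open>g\<close>, hence stays in
  \<open>P\<close>.\<close>

lemma translate_dichotomy:
  assumes g: "g \<in> carrier G" and gK: "g <# K \<subseteq> P"
  shows "g <# (P \<union> K) \<subseteq> P \<or> g <# (Q \<union> K) \<subseteq> P"
proof -
  interpret swapped: cayley_cut G S K Q P by (rule swap)
  have meets: "g \<otimes> \<one> \<in> P" "g \<otimes> \<one> \<in> g <# (P \<union> K)" "g \<otimes> \<one> \<in> g <# (Q \<union> K)"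
    using gK one_K by (auto simp: l_coset_def)
  have disj: "(g <# P) \<inter> (g <# Q) = {}"
    using mem_l_coset_iff[OF g subs(2)] mem_l_coset_iff[OF g subs(3)] disjoint(3)
    unfolding disjoint_iff by simp
  have union: "g <# (P \<union> K) = (g <# P) \<union> (g <# K)" "g <# (Q \<union> K) = (g <# Q) \<union> (g <# K)"
    by (auto simp: l_coset_def)
  have "K \<inter> (g <# K) = {}" using gK disjoint by blast
  then consider "K \<subseteq> g <# P" | "K \<inter> (g <# P) = {}"
    using connected_avoiding_translate[OF connected_K subs(1) g] by blast
  then show ?thesis
  proof cases
    case 1
    then have "(g <# (Q \<union> K)) \<inter> K = {}" using union disj gK disjoint by blast
    then show ?thesis
      using connected_avoiding[OF connected_set_translate[OF swapped.connected_side g]] meets by blast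
  next
    case 2
    then have "(g <# (P \<union> K)) \<inter> K = {}" using union gK disjoint by blast
    then show ?thesis
      using connected_avoiding[OF connected_set_translate[OF connected_side g]] meets by blast
  qed
qed

text \<open>Only the finitely many quotients of elements of \<open>K\<close> move \<open>K\<close>
  to a set meeting it. Any other \<open>g\<close> in \<open>P\<close> works, as its translate of
  \<open>K\<close> is connected and contains \<open>g\<close>.\<close>

lemma exists_deep_translate:
  assumes "infinite P"
  obtains g where "g \<in> carrier G" "g <# K \<subseteq> P"
proof -
  have "finite ((\<lambda>(l, k). l \<otimes> inv k) ` (K \<times> K))" using finite_K by simp
  then have "infinite (P - (\<lambda>(l, k). l \<otimes> inv k) ` (K \<times> K))"
    using assms by (rule Diff_infinite_finite)
  then have "P - (\<lambda>(l, k). l \<otimes> inv k) ` (K \<times> K) \<noteq> {}"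
    using infinite_imp_nonempty by blast
  then obtain g where gP: "g \<in> P" and gn: "g \<notin> (\<lambda>(l, k). l \<otimes> inv k) ` (K \<times> K)"
    by blast
  have g: "g \<in> carrier G" using gP subs by blast
  have "(g <# K) \<inter> K = {}"
  proof (rule ccontr)
    assume "(g <# K) \<inter> K \<noteq> {}"
    then obtain k where k: "k \<in> K" "g \<otimes> k \<in> K" unfolding l_coset_def by blast
    have "k \<in> carrier G" using k subs by blast
    then have "g = g \<otimes> k \<otimes> inv k" using g by (simp add: m_assoc)
    then have "g \<in> (\<lambda>(l, k). l \<otimes> inv k) ` (K \<times> K)" using k by force
    with gn show False ..
  qed
  moreover have "g \<in> g <# K"
    unfolding mem_l_coset_iff[OF g subs(1)] using g one_K by simp
  ultimately have "g <# K \<subseteq> P"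
    using connected_avoiding[OF connected_set_translate[OF connected_K g]] gP by blast
  with g show thesis by (rule that)
qed

lemma exists_push:
  assumes "infinite P" "infinite Q"
  obtains g where "g \<in> carrier G" "g <# (P \<union> K) \<subseteq> P"
proof -
  interpret swapped: cayley_cut G S K Q P by (rule swap)
  obtain g where g: "g \<in> carrier G" "g <# K \<subseteq> P" using exists_deep_translate assms by blast
  obtain h where h: "h \<in> carrier G" "h <# K \<subseteq> Q" using swapped.exists_deep_translate assms by blast
  consider "g <# (P \<union> K) \<subseteq> P" | "h <# (Q \<union> K) \<subseteq> Q" | "g <# (Q \<union> K) \<subseteq> P" "h <# (P \<union> K) \<subseteq> Q"
    using translate_dichotomy[OF g] swapped.translate_dichotomy[OF h] by blast
  then show thesis
  proof cases
    case 1
    with g show thesis using that by blast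
  next
    case 2
    \<comment> \<open>The complements of \<open>Q\<close> and \<open>Q \<union> K\<close> are
      \<open>P \<union> K\<close> and \<open>P\<close>, so complementing the inclusion for
      \<open>h\<close> gives this one for its inverse.\<close>
    have "inv h <# (P \<union> K) \<subseteq> P"
    proof
      fix y assume "y \<in> inv h <# (P \<union> K)"
      then have y: "y \<in> carrier G" "h \<otimes> y \<in> P \<union> K"
        using mem_l_coset_iff[of "inv h" "P \<union> K" y] h(1) subs by auto
      have "y \<notin> Q \<union> K"
      proof
        assume "y \<in> Q \<union> K"
        then have "h \<otimes> y \<in> Q" using 2 unfolding l_coset_def by blast
        then show False using y disjoint by blast
      qed
      then show "y \<in> P" using y carrier_eq by blast
    qed
    then show thesis using that[of "inv h"] h(1) by blast
  next
    case 3
    have "(g \<otimes> h) <# (P \<union> K) \<subseteq> P"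
    proof
      fix y assume "y \<in> (g \<otimes> h) <# (P \<union> K)"
      then obtain x where x: "x \<in> P \<union> K" "y = g \<otimes> h \<otimes> x" unfolding l_coset_def by blast
      then have "h \<otimes> x \<in> Q" using 3(2) unfolding l_coset_def by blast
      then have "g \<otimes> (h \<otimes> x) \<in> P" using 3(1) unfolding l_coset_def by blast
      moreover have "x \<in> carrier G" using x subs by blast
      ultimately show "y \<in> P" using x(2) g(1) h(1) by (simp add: m_assoc)
    qed
    then show thesis using that[of "g \<otimes> h"] g h by blast
  qed
qed

text \<open>An edge leaving \<open>P\<close> ends in the finite set \<open>K\<close>, which settles
  generators and their inverses. An exit under a product is an exit under one of the two factors in
  turn.\<close>

lemma almost_invariant_side: "almost_invariant P"
proof -
  have edge: "finite {x \<in> P. x \<otimes> f \<notin> P}"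
    if f: "f \<in> carrier G" and e: "\<And>x. x \<in> P \<Longrightarrow> x \<rightarrow>\<^bsub>Cay\<^esub> (x \<otimes> f)" for f
  proof (rule finite_subset)
    show "{x \<in> P. x \<otimes> f \<notin> P} \<subseteq> (\<lambda>k. k \<otimes> inv f) ` K"
    proof
      fix x assume "x \<in> {x \<in> P. x \<otimes> f \<notin> P}"
      then have "x \<otimes> f \<in> K" "x \<in> carrier G" using step e subs by blast+
      moreover from this have "x = x \<otimes> f \<otimes> inv f" using f by (simp add: m_assoc)
      ultimately show "x \<in> (\<lambda>k. k \<otimes> inv f) ` K" by blast
    qed
  qed (use finite_K in simp)
  have "f \<in> generate G S \<Longrightarrow> finite {x \<in> P. x \<otimes> f \<notin> P}" for f
  proof (induction rule: generate.induct)
    case one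
    have "{x \<in> P. x \<otimes> \<one> \<notin> P} = {}" using subs by auto
    then show ?case by (simp only: finite.emptyI)
  next
    case (incl s)
    then show ?case using S_sub subs by (intro edge) (auto simp: dominates_iff)
  next
    case (inv s)
    have s: "s \<in> carrier G" using inv S_sub by blast
    show ?case
    proof (rule edge)
      fix x assume "x \<in> P"
      then have x: "x \<in> carrier G" using subs by blast
      then have "x = x \<otimes> inv s \<otimes> s" using s by (simp add: m_assoc)
      then show "x \<rightarrow>\<^bsub>Cay\<^esub> (x \<otimes> inv s)" using x s inv unfolding dominates_iff by auto
    qed (use s in simp)
  next
    case (eng a b)
    then have ab: "a \<in> carrier G" "b \<in> carrier G" using generate_S by auto
    have "{x \<in> P. x \<otimes> (a \<otimes> b) \<notin> P} \<subseteq>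
        {x \<in> P. x \<otimes> a \<notin> P} \<union> (\<lambda>y. y \<otimes> inv a) ` {y \<in> P. y \<otimes> b \<notin> P}"
    proof
      fix x assume "x \<in> {x \<in> P. x \<otimes> (a \<otimes> b) \<notin> P}"
      then have x: "x \<in> P" "x \<in> carrier G" "x \<otimes> a \<otimes> b \<notin> P" using ab subs by (auto simp: m_assoc)
      moreover have "x = x \<otimes> a \<otimes> inv a" using x ab by (simp add: m_assoc)
      ultimately show "x \<in> {x \<in> P. x \<otimes> a \<notin> P} \<union> (\<lambda>y. y \<otimes> inv a) ` {y \<in> P. y \<otimes> b \<notin> P}" by blast
    qed
    then show ?case by (rule finite_subset) (use eng in simp)
  qed
  then show ?thesis using generate_S subs unfolding almost_invariant_def by simp
qed

end

section \<open>Ends\<close>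

context finitely_generated_group
begin

section \<open>Balls as a finite connected exhaustion of the group\<close>

lemma cayley_ball_0: "cayley_ball G S 0 = {\<one>}"
  unfolding cayley_ball_def by (auto simp: Cay.awalk_Nil_iff verts_Cay)

text \<open>Splitting off or appending the last arc of a walk replaces walks by single edges, so
  that facts on balls follow by induction.\<close>

lemma cayley_ball_Suc:
  "cayley_ball G S (Suc n) = cayley_ball G S n \<union> {y. \<exists>x\<in>cayley_ball G S n. x \<rightarrow>\<^bsub>Cay\<^esub> y}"
  (is "?L = ?R")
proof
  show "?L \<subseteq> ?R"
  proof
    fix y assume "y \<in> ?L"
    then obtain p where p: "Cay.awalk \<one> p y" "length p \<le> Suc n" unfolding cayley_ball_def by blast
    show "y \<in> ?R"
    proof (cases p rule: rev_cases)
      case Nil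
      then show ?thesis using p unfolding cayley_ball_def by auto
    next
      case (snoc q e)
      then have q: "Cay.awalk \<one> q (Cay.awlast \<one> q)" and "Cay.awalk (Cay.awlast \<one> q) [e] y"
        using p(1) by auto
      then have "e \<in> arcs Cay" "arc_to_ends Cay e = (Cay.awlast \<one> q, y)"
        by (auto simp: Cay.awalk_Cons_iff Cay.awalk_Nil_iff arc_to_ends_def)
      then have "Cay.awlast \<one> q \<rightarrow>\<^bsub>Cay\<^esub> y" by (intro Cay.dominatesI)
      moreover have "Cay.awlast \<one> q \<in> cayley_ball G S n"
        using q p(2) snoc unfolding cayley_ball_def by auto
      ultimately show ?thesis by blast
    qed
  qed
  show "?R \<subseteq> ?L"
  proof
    fix y assume "y \<in> ?R"
    then consider "y \<in> cayley_ball G S n" | x where "x \<in> cayley_ball G S n" "x \<rightarrow>\<^bsub>Cay\<^esub> y" by blast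
    then show "y \<in> ?L"
    proof cases
      case 1
      then show ?thesis unfolding cayley_ball_def by fastforce
    next
      case 2
      then obtain p where p: "Cay.awalk \<one> p x" "length p \<le> n" unfolding cayley_ball_def by blast
      obtain e where "e \<in> arcs Cay" "tail Cay e = x" "head Cay e = y"
        using 2(2) by (rule reachableE)
      then have "Cay.awalk \<one> (p @ [e]) y"
        using Cay.awalk_appendI[OF p(1)] Cay.arc_implies_awalk by metis
      moreover have "length (p @ [e]) \<le> Suc n" using p by simp
      ultimately show ?thesis unfolding cayley_ball_def by blast
    qed
  qed
qed

lemma one_in_cayley_ball: "\<one> \<in> cayley_ball G S n"
  by (induction n) (simp_all add: cayley_ball_0 cayley_ball_Suc)

lemma cayley_ball_sub: "cayley_ball G S n \<subseteq> carrier G"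
  by (induction n) (auto simp: cayley_ball_0 cayley_ball_Suc dest: dominates_carrier)

lemma finite_cayley_ball: "finite (cayley_ball G S n)"
proof (induction n)
  case (Suc n)
  have "{y. \<exists>x\<in>cayley_ball G S n. x \<rightarrow>\<^bsub>Cay\<^esub> y} = (\<Union>x\<in>cayley_ball G S n. {y. x \<rightarrow>\<^bsub>Cay\<^esub> y})"
    by blast
  then show ?case using Suc finite_dominated by (simp add: cayley_ball_Suc)
qed (simp add: cayley_ball_0)

lemma cayley_ball_mono: "m \<le> n \<Longrightarrow> cayley_ball G S m \<subseteq> cayley_ball G S n"
  by (rule lift_Suc_mono_le[of "cayley_ball G S"]) (auto simp: cayley_ball_Suc)

lemma connected_cayley_ball: "connected_set (cayley_ball G S n)"
proof (induction n)
  case 0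
  then show ?case unfolding cayley_ball_0 connected_set_def by blast
next
  case (Suc n)
  let ?B = "cayley_ball G S n" and ?B' = "cayley_ball G S (Suc n)"
  show ?case
    unfolding connected_set_def
  proof (intro allI impI)
    fix C assume C: "\<forall>x\<in>?B' \<inter> C. \<forall>y\<in>?B'. x \<rightarrow>\<^bsub>Cay\<^esub> y \<longrightarrow> y \<in> C"
    have sub: "?B \<subseteq> ?B'" by (simp add: cayley_ball_mono)
    have "?B \<subseteq> C \<or> ?B \<inter> C = {}"
      by (rule connected_setD[OF Suc]) (use C sub in blast)
    moreover have "\<exists>x\<in>?B. x = y \<or> x \<rightarrow>\<^bsub>Cay\<^esub> y" if "y \<in> ?B'" for y
      using that unfolding cayley_ball_Suc by blast
    ultimately show "?B' \<subseteq> C \<or> ?B' \<inter> C = {}"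
      using C sub dominates_sym by blast
  qed
qed

lemma cayley_ball_cover: "carrier G = (\<Union>n. cayley_ball G S n)"
proof -
  have "carrier G \<subseteq> (\<Union>n. cayley_ball G S n) \<or> carrier G \<inter> (\<Union>n. cayley_ball G S n) = {}"
  proof (rule connected_setD[OF connected_set_carrier])
    fix x y assume "x \<in> (\<Union>n. cayley_ball G S n)" "x \<rightarrow>\<^bsub>Cay\<^esub> y"
    then show "y \<in> (\<Union>n. cayley_ball G S n)" using cayley_ball_Suc by blast
  qed
  then show ?thesis using one_in_cayley_ball cayley_ball_sub by blast
qed

lemma bounded_iff_finite:
  assumes "C \<subseteq> carrier G"
  shows "(\<exists>m. C \<subseteq> cayley_ball G S m) \<longleftrightarrow> finite C"
proof
  assume "\<exists>m. C \<subseteq> cayley_ball G S m"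
  then show "finite C" using finite_cayley_ball finite_subset by blast
next
  assume "finite C"
  then show "\<exists>m. C \<subseteq> cayley_ball G S m"
    using assms
  proof (induction C)
    case (insert x C)
    then obtain m where "C \<subseteq> cayley_ball G S m" by blast
    moreover obtain k where "x \<in> cayley_ball G S k" using insert.prems cayley_ball_cover by blast
    ultimately have "insert x C \<subseteq> cayley_ball G S (max m k)"
      using cayley_ball_mono[of m "max m k"] cayley_ball_mono[of k "max m k"] by auto
    then show ?case ..
  qed simp
qed

section \<open>Components of the complement of a ball\<close>

abbreviation outside :: "nat \<Rightarrow> ('a, 'a \<times> 'a) pre_digraph" where
  "outside n \<equiv> Cay \<restriction> (carrier G - cayley_ball G S n)"

lemma outside_dominates_iff:
  "x \<rightarrow>\<^bsub>outside n\<^esub> y \<longleftrightarrow> x \<rightarrow>\<^bsub>Cay\<^esub> y \<and> x \<notin> cayley_ball G S n \<and> y \<notin> cayley_ball G S n"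
proof -
  have "x \<rightarrow>\<^bsub>outside n\<^esub> y \<longleftrightarrow>
      x \<rightarrow>\<^bsub>Cay\<^esub> y \<and> x \<in> carrier G - cayley_ball G S n \<and> y \<in> carrier G - cayley_ball G S n"
    by (auto simp: arcs_ends_conv image_iff)
  then show ?thesis using dominates_carrier by blast
qed

lemma sym_digraph_outside: "sym_digraph (outside n)"
proof
  show "tail (outside n) e \<in> verts (outside n)" "head (outside n) e \<in> verts (outside n)"
    if "e \<in> arcs (outside n)" for e
    using that by auto
  show "symmetric (outside n)"
    unfolding symmetric_def sym_def outside_dominates_iff using dominates_sym by blast
qed

lemma component_sub: "C \<in> pre_digraph.sccs_verts (outside n) \<Longrightarrow> C \<subseteq> carrier G - cayley_ball G S n"
  using wf_digraph.sccs_verts_subsets[of "outside n" C] sym_digraph_outside[of n]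
  by (simp add: sym_digraph_def)

text \<open>By symmetry a single edge outside the ball already gives reachability in both
  directions.\<close>

lemma component_closed:
  assumes C: "C \<in> pre_digraph.sccs_verts (outside n)" and x: "x \<in> C" and xy: "x \<rightarrow>\<^bsub>Cay\<^esub> y"
    and y: "y \<notin> cayley_ball G S n"
  shows "y \<in> C"
proof -
  interpret outside: sym_digraph "outside n" by (rule sym_digraph_outside)
  have "x \<notin> cayley_ball G S n" using component_sub[OF C] x by blast
  then have "x \<rightarrow>\<^bsub>outside n\<^esub> y" "y \<rightarrow>\<^bsub>outside n\<^esub> x"
    using xy y dominates_sym unfolding outside_dominates_iff by blast+
  then have "x \<rightarrow>\<^sup>*\<^bsub>outside n\<^esub> y" "y \<rightarrow>\<^sup>*\<^bsub>outside n\<^esub> x" by (blast intro: outside.reachable_adjI)+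
  then show ?thesis using C x unfolding outside.in_sccs_verts_conv_reachable by blast
qed

lemma component_disjoint:
  assumes "C \<in> pre_digraph.sccs_verts (outside n)" "D \<in> pre_digraph.sccs_verts (outside n)" "C \<noteq> D"
  shows "C \<inter> D = {}"
  using wf_digraph.sccs_verts_disjoint[OF _ assms] sym_digraph_outside[of n]
  by (simp add: sym_digraph_def)

lemma component_nonempty: "C \<in> pre_digraph.sccs_verts (outside n) \<Longrightarrow> C \<noteq> {}"
  by (simp add: pre_digraph.sccs_verts_def)

text \<open>A component missing the next ball would have no edge into the ball of radius
  \<open>n\<close>, hence be closed under all edges of the connected Cayley graph.\<close>

lemma component_adjacent_to_ball:
  assumes C: "C \<in> pre_digraph.sccs_verts (outside n)"
  shows "C \<inter> cayley_ball G S (Suc n) \<noteq> {}"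
proof
  assume empty: "C \<inter> cayley_ball G S (Suc n) = {}"
  have "carrier G \<subseteq> C \<or> carrier G \<inter> C = {}"
  proof (rule connected_setD[OF connected_set_carrier])
    fix x y assume x: "x \<in> C" and xy: "x \<rightarrow>\<^bsub>Cay\<^esub> y"
    have "y \<notin> cayley_ball G S n"
      using dominates_sym[OF xy] x empty unfolding cayley_ball_Suc by blast
    then show "y \<in> C" using component_closed[OF C x xy] by blast
  qed
  then show False using component_nonempty[OF C] component_sub[OF C] one_in_cayley_ball by blast
qed

text \<open>Components are disjoint and have nonempty traces on the next ball, so these traces,
  subsets of a finite set, determine them.\<close>

lemma finite_components: "finite (pre_digraph.sccs_verts (outside n))"
proof -
  let ?D = "pre_digraph.sccs_verts (outside n)" and ?B = "cayley_ball G S (Suc n)"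
  have "inj_on (\<lambda>C. C \<inter> ?B) ?D"
  proof (rule inj_onI)
    fix C D assume C: "C \<in> ?D" and D: "D \<in> ?D" and eq: "C \<inter> ?B = D \<inter> ?B"
    have "C \<inter> ?B \<noteq> {}" using component_adjacent_to_ball[OF C] .
    then have "C \<inter> D \<noteq> {}" using eq by auto
    then show "C = D" using component_disjoint[OF C D] by blast
  qed
  moreover have "(\<lambda>C. C \<inter> ?B) ` ?D \<subseteq> Pow ?B" by blast
  then have "finite ((\<lambda>C. C \<inter> ?B) ` ?D)" by (rule finite_subset) (simp add: finite_cayley_ball)
  ultimately show ?thesis by (simp add: finite_image_iff)
qed

lemma unbounded_components_eq:
  "unbounded_components G S n = {C \<in> pre_digraph.sccs_verts (outside n). infinite C}"
  unfolding unbounded_components_def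
proof (intro Collect_cong conj_cong refl)
  fix C assume "C \<in> pre_digraph.sccs_verts (outside n)"
  then have "C \<subseteq> carrier G" using component_sub by blast
  then show "(\<forall>m. \<not> C \<subseteq> cayley_ball G S m) \<longleftrightarrow> infinite C" using bounded_iff_finite[of C] by blast
qed

lemma unbounded_component_exists:
  assumes "infinite (carrier G)"
  shows "unbounded_components G S n \<noteq> {}"
proof
  assume empty: "unbounded_components G S n = {}"
  interpret outside: sym_digraph "outside n" by (rule sym_digraph_outside)
  have "carrier G - cayley_ball G S n \<subseteq> \<Union> outside.sccs_verts"
  proof
    fix x assume "x \<in> carrier G - cayley_ball G S n"
    then have "x \<in> verts (outside n)" by simp
    then have "outside.scc_of x \<in> outside.sccs_verts" and "x \<in> outside.scc_of x"
      using outside.scc_of_in_sccs_verts[of x] outside.reachable_refl[of x]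
      unfolding outside.scc_of_def by blast+
    then show "x \<in> \<Union> outside.sccs_verts" by blast
  qed
  moreover have "finite (\<Union> outside.sccs_verts)"
    using empty finite_components unfolding unbounded_components_eq by blast
  ultimately have "finite (carrier G - cayley_ball G S n)" by (rule finite_subset)
  then show False using assms finite_cayley_ball by simp
qed

text \<open>If no radius had two, the counting sequence would be constant, 0 for a finite group and
  1 for an infinite one, and so would be its limit.\<close>

lemma two_unbounded_components:
  assumes "number_of_ends G S \<ge> 2"
  obtains n C D where "C \<in> unbounded_components G S n" "D \<in> unbounded_components G S n" "C \<noteq> D"
proof (rule ccontr)
  note two = that
  assume no: "\<not> thesis"
  have unique: "C = D"
    if "C \<in> unbounded_components G S n" "D \<in> unbounded_components G S n" for n C D
    using two[OF that] no by blast
  define c :: enat where "c = (if finite (carrier G) then 0 else 1)"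
  have eq: "(if finite (unbounded_components G S n) then enat (card (unbounded_components G S n)) else \<infinity>) = c"
    for n
  proof (cases "finite (carrier G)")
    case True
    have "unbounded_components G S n = {}"
      using component_sub True finite_subset unfolding unbounded_components_eq by blast
    then show ?thesis using True by (simp add: c_def zero_enat_def)
  next
    case False
    obtain C where "C \<in> unbounded_components G S n" using unbounded_component_exists[OF False] by blast
    then have "unbounded_components G S n = {C}" using unique by blast
    then show ?thesis using False by (simp add: c_def one_enat_def)
  qed
  have "number_of_ends G S = c" unfolding number_of_ends_def eq by (rule limI) (rule tendsto_const)
  then show False using assms by (auto simp: c_def split: if_splits)
qed

lemma exists_pushed_almost_invariant:
  assumes "number_of_ends G S \<ge> 2"
  obtains g H where "g \<in> carrier G" "\<forall>x\<in>H. g \<otimes> x \<in> H" "almost_invariant H" "\<one> \<notin> H" "g \<otimes> \<one> \<in> H"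
proof -
  obtain n P D where P: "P \<in> unbounded_components G S n" and D: "D \<in> unbounded_components G S n"
    and "P \<noteq> D"
    using two_unbounded_components[OF assms] .
  \<comment> \<open>\<open>Q\<close> is everything else outside the ball, so that the cut covers the
    group; the second component \<open>D\<close> only serves to make it infinite.\<close>
  define Q where "Q = carrier G - cayley_ball G S n - P"
  have comp: "P \<in> pre_digraph.sccs_verts (outside n)" "D \<in> pre_digraph.sccs_verts (outside n)"
    and inf: "infinite P" "infinite D"
    using P D unfolding unbounded_components_eq by auto
  have "D \<subseteq> Q"
    using component_disjoint[OF comp \<open>P \<noteq> D\<close>] component_sub[OF comp(2)] unfolding Q_def by blast
  then have "infinite Q" using inf(2) finite_subset by blast
  interpret cayley_cut G S "cayley_ball G S n" P Q
  proof
    show "\<not> x \<rightarrow>\<^bsub>Cay\<^esub> y" if "x \<in> P" "y \<in> Q" for x y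
      using component_closed[OF comp(1), of x y] that unfolding Q_def by blast
    show "carrier G = cayley_ball G S n \<union> P \<union> Q" "cayley_ball G S n \<inter> P = {}"
      using component_sub[OF comp(1)] cayley_ball_sub[of n] unfolding Q_def by blast+
  qed (auto simp: finite_cayley_ball one_in_cayley_ball connected_cayley_ball Q_def)
  obtain g where g: "g \<in> carrier G" "g <# (P \<union> cayley_ball G S n) \<subseteq> P"
    using exists_push[OF inf(1) \<open>infinite Q\<close>] .
  show thesis
  proof (rule that[of g P])
    \<comment> \<open>Including the ball in the pushed set makes the push strict:
      \<open>\<one>\<close> is in the ball, hence outside \<open>P\<close>, but is moved into
      \<open>P\<close>.\<close>
    show "\<forall>x\<in>P. g \<otimes> x \<in> P" "g \<otimes> \<one> \<in> P" using g(2) one_K unfolding l_coset_def by blast+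
    show "\<one> \<notin> P" using one_K disjoint by blast
  qed (use g almost_invariant_side in auto)
qed

end

theorem theorem1p5:
  fixes G :: "('g, 'm) monoid_scheme" and S :: "'g set"
  assumes "group G"
    and "finite S" and "S \<subseteq> carrier G" and "generate G S = carrier G"
    and "number_of_ends G S \<ge> 2"
  shows "\<not> (\<exists>(A :: 'a set) X. finite A \<and>
            subshift_of_finite_type G A X \<and> strongly_aperiodic G A X)"
proof -
  interpret finitely_generated_group G S
    using assms by (simp add: finitely_generated_group_def finitely_generated_group_axioms_def)
  obtain g H where g: "g \<in> carrier G" "\<forall>x\<in>H. g \<otimes>\<^bsub>G\<^esub> x \<in> H" "almost_invariant H"
      "\<one>\<^bsub>G\<^esub> \<notin> H" "g \<otimes>\<^bsub>G\<^esub> \<one>\<^bsub>G\<^esub> \<in> H"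
    using exists_pushed_almost_invariant[OF assms(5)] .
  show ?thesis
    using not_strongly_aperiodic_of_push[OF g(1,2,3) one_closed g(4,5)] by blast
qed

end
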